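(* Let $\lambda_c,\mu_c,\nu_c,p_c>0$ for $c\in\mathcal{C}=\{1,\dots,C\}$, with $\sum_c p_c=1$, satisfy $$\max_{c\in\mathcal{C}}\frac{\lambda_c}{\nu_c}<1-\sum_{d\in\mathcal{C}}\frac{\lambda_d}{\mu_d}.$$ For every initial state $x^\infty\in E^1$ with finite mass, the solution $x(t)$ of the initial-value problem $$\frac{dx(t)}{dt}=H(x(t)),\qquad x(0)=x^\infty,$$ with $$H(x)=\sum_{c\in\mathcal{C}}\frac1{p_c}\Big(\lambda_c\sum_{n=0}^\infty x_{c,n}(e_{c,n+1}-e_{c,n})+\pi^b_{x_0}\,\nu_c\sum_{n=1}^\infty x_{c,n}(e_{c,n-1}-e_{c,n})\Big),\qquad \pi^b_{x_0}=\frac{1}{1+\sum_{c\in\mathcal{C}}\frac{\nu_c}{\mu_c}(1-x_{c,0})},$$ satisfies $x(t)\to x^*$ as $t\to\infty$, where $x^*\in E^1$ is given by $$x^*_{c,n}=(1-\xi_c)\xi_c^n,\qquad \xi_c=\frac{\lambda_c}{\nu_c\big(1-\sum_{d\in\mathcal{C}}\frac{\lambda_d}{\mu_d}\big)}.$$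
   Context: $E^1=\{x=(x_{c,n})_{c\in\mathcal{C},n\in\mathbb{N}_0}:x_{c,n}\ge0,\ \sum_{n\ge0}x_{c,n}=1\ \forall c\}$ with metric $\rho(x,y)=\sum_c\sum_{n\ge0}2^{-n}\frac{|x_{c,n}-y_{c,n}|}{1+|x_{c,n}-y_{c,n}|}$; convergence is with respect to $\rho$. $e_{c,n}$ is the unit vector with a $1$ in position $(c,n)$. The (class-$c$) mass of $x\in E^1$ is $m_c(x)=\sum_{n\ge1}n\,x_{c,n}$; $x$ has finite mass if $\sum_{c\in\mathcal{C}}m_c(x)<\infty$. The initial-value problem has a unique solution, which remains in $E^1$. (It is the mean-field limit of a random-access network with complete interference graph.) *)

theory Defs
  imports "HOL-Analysis.Analysis"
begin

text \<open>The finite set of classes is the universe of a finite type \<open>'c\<close>; a state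
  \<open>x\<close> has coordinates \<open>x c n\<close>.\<close>

type_synonym 'c state = "'c \<Rightarrow> nat \<Rightarrow> real"

definition E1 :: "'c::finite state set" where
  "E1 = {x. (\<forall>c n. 0 \<le> x c n) \<and> (\<forall>c. (\<lambda>n. x c n) sums 1)}"

definition rho :: "'c::finite state \<Rightarrow> 'c state \<Rightarrow> real" where
  "rho x y = (\<Sum>c\<in>UNIV. \<Sum>n. (1 / 2 ^ n) * (\<bar>x c n - y c n\<bar> / (1 + \<bar>x c n - y c n\<bar>)))"

definition unit_vec :: "'c \<Rightarrow> nat \<Rightarrow> 'c state" where
  "unit_vec c n = (\<lambda>d k. if d = c \<and> k = n then 1 else 0)"

definition mass :: "'c \<Rightarrow> 'c state \<Rightarrow> ennreal" where
  "mass c x = (\<Sum>n. ennreal (real (Suc n) * x c (Suc n)))"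

definition finite_mass :: "'c::finite state \<Rightarrow> bool" where
  "finite_mass x \<longleftrightarrow> (\<Sum>c\<in>UNIV. mass c x) < \<infinity>"

definition pi_b :: "('c::finite \<Rightarrow> real) \<Rightarrow> ('c \<Rightarrow> real) \<Rightarrow> 'c state \<Rightarrow> real" where
  "pi_b mu nu x = 1 / (1 + (\<Sum>c\<in>UNIV. nu c / mu c * (1 - x c 0)))"

text \<open>The series of vectors are taken coordinatewise, at the coordinate \<open>(d, k)\<close>; there each
  of them has at most two nonzero terms.  The sums over \<open>n \<ge> 1\<close> are reindexed by \<open>Suc n\<close>.\<close>

definition H :: "('c::finite \<Rightarrow> real) \<Rightarrow> ('c \<Rightarrow> real) \<Rightarrow> ('c \<Rightarrow> real) \<Rightarrow> ('c \<Rightarrow> real)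
    \<Rightarrow> 'c state \<Rightarrow> 'c state" where
  "H lam mu nu p x = (\<lambda>d k. \<Sum>c\<in>UNIV. 1 / p c *
     (lam c * (\<Sum>n. x c n * (unit_vec c (Suc n) d k - unit_vec c n d k))
      + pi_b mu nu x * nu c *
          (\<Sum>n. x c (Suc n) * (unit_vec c n d k - unit_vec c (Suc n) d k))))"

text \<open>A solution is a trajectory in \<^const>\<open>E1\<close> on \<open>[0, \<infinity>)\<close>.  Convergence in \<^const>\<open>rho\<close> is
  coordinatewise convergence, so the derivative is the coordinatewise one (one-sided at time 0).
  The values \<open>x t\<close> for \<open>t < 0\<close> are irrelevant.\<close>

definition solves_ivp :: "('c::finite \<Rightarrow> real) \<Rightarrow> ('c \<Rightarrow> real) \<Rightarrow> ('c \<Rightarrow> real) \<Rightarrow> ('c \<Rightarrow> real)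
    \<Rightarrow> 'c state \<Rightarrow> (real \<Rightarrow> 'c state) \<Rightarrow> bool" where
  "solves_ivp lam mu nu p x_init x \<longleftrightarrow>
     x 0 = x_init \<and>
     (\<forall>t\<ge>0. x t \<in> E1) \<and>
     (\<forall>t\<ge>0. \<forall>c n. ((\<lambda>s. x s c n) has_real_derivative H lam mu nu p (x t) c n)
                     (at t within {0..}))"

definition xi :: "('c::finite \<Rightarrow> real) \<Rightarrow> ('c \<Rightarrow> real) \<Rightarrow> ('c \<Rightarrow> real) \<Rightarrow> 'c \<Rightarrow> real" where
  "xi lam mu nu c = lam c / (nu c * (1 - (\<Sum>d\<in>UNIV. lam d / mu d)))"

definition x_star :: "('c::finite \<Rightarrow> real) \<Rightarrow> ('c \<Rightarrow> real) \<Rightarrow> ('c \<Rightarrow> real) \<Rightarrow> 'c state" where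
  "x_star lam mu nu = (\<lambda>c n. (1 - xi lam mu nu c) * xi lam mu nu c ^ n)"

end

theory Submission
  imports Defs
begin

text \<open>In terms of the tails \<open>s_{c,n}\<close> (the sum of \<open>x_{c,k}\<close> over \<open>k \<ge> n\<close>) the system is cooperative:
  longer queues lower the service rate \<open>\<pi>\<close>, which lengthens all queues. Together with the mass balance
  this makes the weighted distance
  \<open>\<Sum>_c (p_c / \<mu>_c) \<Sum>_n \<bar>s_{c,n} - \<xi>_c^n\<bar>\<close> to the equilibrium a Lyapunov function, finite at time
  0 because the initial mass is finite, which decreases at a rate of at least a constant times
  \<open>\<Sum>_c (\<nu>_c / \<mu>_c) \<bar>s_{c,1} - \<xi>_c\<bar>\<close>. The latter is therefore integrable over time, and, being
  Lipschitz, tends to 0. Hence \<open>\<pi>\<close> converges, and Barbalat's lemma, applied to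
  \<open>p_c s_{c,n+1}' = \<lambda>_c x_{c,n} - \<pi> \<nu>_c x_{c,n+1}\<close>, propagates the convergence from \<open>n\<close> to
  \<open>n + 1\<close>.\<close>

section \<open>Barbalat's lemma\<close>

text \<open>By the mean value theorem some \<open>f' z\<close> with z in [t, t + h] is a difference
  quotient of \<open>f\<close>, hence small once \<open>f\<close> is close to \<open>L\<close> at
  both ends. The Lipschitz condition moves the estimate from z to t at the cost
  \<open>C * h\<close>.\<close>

lemma barbalat:
  fixes f :: "real \<Rightarrow> real"
  assumes deriv: "\<And>t. 0 \<le> t \<Longrightarrow> (f has_real_derivative f' t) (at t within {0..})"
    and lip: "C-lipschitz_on {0..} f'"
    and lim: "(f \<longlongrightarrow> L) at_top"
  shows "(f' \<longlongrightarrow> 0) at_top"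
proof (rule tendstoI)
  fix e :: real assume "0 < e"
  have C: "0 \<le> C" using lip by (rule lipschitz_on_nonneg)
  \<comment> \<open>This window keeps \<open>C * h\<close> below e / 2; the \<open>+ 1\<close>
    covers C = 0.\<close>
  define h where "h = e / (2 * (C + 1))"
  have h: "0 < h" using \<open>0 < e\<close> C by (simp add: h_def)
  have Ch: "C * h \<le> e / 2" using \<open>0 < e\<close> C by (simp add: h_def field_simps)
  have "eventually (\<lambda>t. dist (f t) L < e * h / 4) at_top"
    using lim \<open>0 < e\<close> h by (intro tendstoD) auto
  then obtain T where T: "\<And>t. T \<le> t \<Longrightarrow> \<bar>f t - L\<bar> < e * h / 4"
    by (auto simp: eventually_at_top_linorder dist_real_def)
  have "dist (f' t) 0 < e" if "max T 0 \<le> t" for t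
  proof -
    have t: "0 \<le> t" "T \<le> t" using that by auto
    have "\<exists>z\<in>{t..t + h}. f (t + h) - f t = f' z * (t + h - t)"
    proof (rule mvt_very_simple)
      show "t \<le> t + h" using h by simp
      fix z assume "t \<le> z" "z \<le> t + h"
      then have "(f has_real_derivative f' z) (at z within {t..t + h})"
        using t by (intro DERIV_subset[OF deriv]) auto
      then show "(f has_derivative (*) (f' z)) (at z within {t..t + h})"
        by (simp add: has_field_derivative_def)
    qed
    then obtain z where z: "t \<le> z" "z \<le> t + h" "f (t + h) - f t = f' z * h" by auto
    have "\<bar>f' z\<bar> * h = \<bar>f (t + h) - f t\<bar>" using z h by (simp add: abs_mult)
    also have "\<dots> < e * h / 4 + e * h / 4" using T[of t] T[of "t + h"] t h by linarith
    also have "\<dots> = (e / 2) * h" by simp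
    finally have 1: "\<bar>f' z\<bar> < e / 2" using h by simp
    have "\<bar>f' z - f' t\<bar> \<le> C * \<bar>z - t\<bar>"
      using lipschitz_onD[OF lip, of z t] t z by (simp add: dist_real_def)
    also have "\<dots> \<le> C * h" using z C by (intro mult_left_mono) auto
    finally show ?thesis using 1 Ch by (simp add: dist_real_def)
  qed
  then show "eventually (\<lambda>t. dist (f' t) 0 < e) at_top"
    unfolding eventually_at_top_linorder by blast
qed

section \<open>Bounded Lipschitz functions on the half-line\<close>

definition bdd_lipschitz :: "(real \<Rightarrow> real) \<Rightarrow> bool" where
  "bdd_lipschitz f \<longleftrightarrow> bounded (f ` {0..}) \<and> (\<exists>C. C-lipschitz_on {0..} f)"

lemma bdd_lipschitzI:
  assumes "\<And>t. 0 \<le> t \<Longrightarrow> \<bar>f t\<bar> \<le> B"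
    and "\<And>t u. 0 \<le> t \<Longrightarrow> 0 \<le> u \<Longrightarrow> \<bar>f t - f u\<bar> \<le> C * \<bar>t - u\<bar>"
  shows "bdd_lipschitz f"
proof -
  have "bounded (f ` {0..})" unfolding bounded_iff using assms(1) by auto
  \<comment> \<open>\<open>lipschitz_on\<close> demands a nonnegative constant, while the sign of
    \<open>C\<close> is not known here.\<close>
  moreover have "\<bar>C\<bar>-lipschitz_on {0..} f"
  proof (rule lipschitz_onI)
    fix t u :: real assume "t \<in> {0..}" "u \<in> {0..}"
    then have "\<bar>f t - f u\<bar> \<le> C * \<bar>t - u\<bar>" using assms(2) by simp
    also have "\<dots> \<le> \<bar>C\<bar> * \<bar>t - u\<bar>" by (intro mult_right_mono) auto
    finally show "dist (f t) (f u) \<le> \<bar>C\<bar> * dist t u" by (simp add: dist_real_def)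
  qed simp
  ultimately show ?thesis unfolding bdd_lipschitz_def by blast
qed

lemma bdd_lipschitzE:
  assumes "bdd_lipschitz f"
  obtains B C where "0 \<le> B" "0 \<le> C" "\<And>t. 0 \<le> t \<Longrightarrow> \<bar>f t\<bar> \<le> B"
    "\<And>t u. 0 \<le> t \<Longrightarrow> 0 \<le> u \<Longrightarrow> \<bar>f t - f u\<bar> \<le> C * \<bar>t - u\<bar>"
proof -
  obtain B where B: "\<And>t. 0 \<le> t \<Longrightarrow> \<bar>f t\<bar> \<le> B"
    using assms unfolding bdd_lipschitz_def bounded_iff by auto
  obtain C where C: "C-lipschitz_on {0..} f"
    using assms unfolding bdd_lipschitz_def by auto
  show thesis
    using that[of B C] B[of 0] B lipschitz_on_nonneg[OF C] lipschitz_onD[OF C]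
    by (fastforce simp: dist_real_def)
qed

lemma bdd_lipschitz_const: "bdd_lipschitz (\<lambda>t. a)"
  by (rule bdd_lipschitzI[of _ "\<bar>a\<bar>" 0]) auto

lemma bdd_lipschitz_add:
  assumes "bdd_lipschitz f" "bdd_lipschitz g"
  shows "bdd_lipschitz (\<lambda>t. f t + g t)"
proof -
  obtain B C where f: "0 \<le> B" "0 \<le> C" "\<And>t. 0 \<le> t \<Longrightarrow> \<bar>f t\<bar> \<le> B"
    "\<And>t u. 0 \<le> t \<Longrightarrow> 0 \<le> u \<Longrightarrow> \<bar>f t - f u\<bar> \<le> C * \<bar>t - u\<bar>"
    using assms(1) by (rule bdd_lipschitzE) blast
  obtain B' C' where g: "0 \<le> B'" "0 \<le> C'" "\<And>t. 0 \<le> t \<Longrightarrow> \<bar>g t\<bar> \<le> B'"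
    "\<And>t u. 0 \<le> t \<Longrightarrow> 0 \<le> u \<Longrightarrow> \<bar>g t - g u\<bar> \<le> C' * \<bar>t - u\<bar>"
    using assms(2) by (rule bdd_lipschitzE) blast
  show ?thesis
  proof (rule bdd_lipschitzI[of _ "B + B'" "C + C'"])
    fix t :: real assume "0 \<le> t"
    then show "\<bar>f t + g t\<bar> \<le> B + B'" using f(3)[of t] g(3)[of t] by linarith
  next
    fix t u :: real assume "0 \<le> t" "0 \<le> u"
    then show "\<bar>f t + g t - (f u + g u)\<bar> \<le> (C + C') * \<bar>t - u\<bar>"
      using f(4)[of t u] g(4)[of t u] by (simp add: distrib_right)
  qed
qed

text \<open>This rule is why \<open>bdd_lipschitz\<close> includes boundedness: the product rule for
  differences multiplies each Lipschitz constant by a bound of the other factor.\<close>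

lemma bdd_lipschitz_mult:
  assumes "bdd_lipschitz f" "bdd_lipschitz g"
  shows "bdd_lipschitz (\<lambda>t. f t * g t)"
proof -
  obtain B C where f: "0 \<le> B" "0 \<le> C" "\<And>t. 0 \<le> t \<Longrightarrow> \<bar>f t\<bar> \<le> B"
    "\<And>t u. 0 \<le> t \<Longrightarrow> 0 \<le> u \<Longrightarrow> \<bar>f t - f u\<bar> \<le> C * \<bar>t - u\<bar>"
    using assms(1) by (rule bdd_lipschitzE) blast
  obtain B' C' where g: "0 \<le> B'" "0 \<le> C'" "\<And>t. 0 \<le> t \<Longrightarrow> \<bar>g t\<bar> \<le> B'"
    "\<And>t u. 0 \<le> t \<Longrightarrow> 0 \<le> u \<Longrightarrow> \<bar>g t - g u\<bar> \<le> C' * \<bar>t - u\<bar>"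
    using assms(2) by (rule bdd_lipschitzE) blast
  show ?thesis
  proof (rule bdd_lipschitzI[of _ "B * B'" "B * C' + B' * C"])
    fix t :: real assume "0 \<le> t"
    then show "\<bar>f t * g t\<bar> \<le> B * B'"
      using f g by (simp add: abs_mult mult_mono)
  next
    fix t u :: real assume tu: "0 \<le> t" "0 \<le> u"
    have "f t * g t - f u * g u = f t * (g t - g u) + g u * (f t - f u)"
      by (simp add: algebra_simps)
    then have "\<bar>f t * g t - f u * g u\<bar> \<le> \<bar>f t\<bar> * \<bar>g t - g u\<bar> + \<bar>g u\<bar> * \<bar>f t - f u\<bar>"
      using abs_triangle_ineq[of "f t * (g t - g u)" "g u * (f t - f u)"] by (simp add: abs_mult)
    also have "\<dots> \<le> B * (C' * \<bar>t - u\<bar>) + B' * (C * \<bar>t - u\<bar>)"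
      using f g tu by (intro add_mono mult_mono) auto
    finally show "\<bar>f t * g t - f u * g u\<bar> \<le> (B * C' + B' * C) * \<bar>t - u\<bar>"
      by (simp add: algebra_simps)
  qed
qed

lemma bdd_lipschitz_diff:
  assumes "bdd_lipschitz f" "bdd_lipschitz g"
  shows "bdd_lipschitz (\<lambda>t. f t - g t)"
  using bdd_lipschitz_add[OF assms(1) bdd_lipschitz_mult[OF bdd_lipschitz_const[of "-1"] assms(2)]]
  by simp

lemma bdd_lipschitz_sum:
  assumes "\<And>i. i \<in> I \<Longrightarrow> bdd_lipschitz (f i)"
  shows "bdd_lipschitz (\<lambda>t. \<Sum>i\<in>I. f i t)"
  using assms
  by (induction I rule: infinite_finite_induct)
    (auto intro: bdd_lipschitz_const bdd_lipschitz_add)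

lemma bdd_lipschitz_abs:
  assumes "bdd_lipschitz f"
  shows "bdd_lipschitz (\<lambda>t. \<bar>f t\<bar>)"
proof -
  obtain B C where f: "0 \<le> B" "0 \<le> C" "\<And>t. 0 \<le> t \<Longrightarrow> \<bar>f t\<bar> \<le> B"
    "\<And>t u. 0 \<le> t \<Longrightarrow> 0 \<le> u \<Longrightarrow> \<bar>f t - f u\<bar> \<le> C * \<bar>t - u\<bar>"
    using assms(1) by (rule bdd_lipschitzE) blast
  show ?thesis
    using f(3) order_trans[OF abs_triangle_ineq3 f(4)] by (intro bdd_lipschitzI[of _ B C]) auto
qed

text \<open>The difference of reciprocals has denominator \<open>f t * f u\<close>, which is at
  least 1, so the Lipschitz constant of \<open>f\<close> survives.\<close>

lemma bdd_lipschitz_inverse: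
  assumes "bdd_lipschitz f" and ge: "\<And>t. 0 \<le> t \<Longrightarrow> 1 \<le> f t"
  shows "bdd_lipschitz (\<lambda>t. 1 / f t)"
proof -
  obtain B C where f: "0 \<le> B" "0 \<le> C" "\<And>t. 0 \<le> t \<Longrightarrow> \<bar>f t\<bar> \<le> B"
    "\<And>t u. 0 \<le> t \<Longrightarrow> 0 \<le> u \<Longrightarrow> \<bar>f t - f u\<bar> \<le> C * \<bar>t - u\<bar>"
    using assms(1) by (rule bdd_lipschitzE) blast
  show ?thesis
  proof (rule bdd_lipschitzI[of _ 1 C])
    fix t :: real assume "0 \<le> t"
    then show "\<bar>1 / f t\<bar> \<le> 1" using ge[of t] by (simp add: divide_le_eq)
  next
    fix t u :: real assume tu: "0 \<le> t" "0 \<le> u"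
    have ge1: "1 \<le> f t" "1 \<le> f u" using ge tu by auto
    then have "1 * 1 \<le> f t * f u" by (intro mult_mono) auto
    then have "\<bar>f u - f t\<bar> / (f t * f u) \<le> \<bar>f u - f t\<bar> / 1"
      by (intro divide_left_mono) auto
    moreover have "1 / f t - 1 / f u = (f u - f t) / (f t * f u)"
      using ge1 by (simp add: field_simps)
    ultimately show "\<bar>1 / f t - 1 / f u\<bar> \<le> C * \<bar>t - u\<bar>"
      using f(4)[OF tu] ge1 by (simp add: abs_mult abs_minus_commute)
  qed
qed

lemma bdd_lipschitz_deriv:
  assumes "\<And>t. 0 \<le> t \<Longrightarrow> \<bar>f t\<bar> \<le> B"
    and "\<And>t. 0 \<le> t \<Longrightarrow> (f has_real_derivative f' t) (at t within {0..})"
    and "\<And>t. 0 \<le> t \<Longrightarrow> \<bar>f' t\<bar> \<le> C"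
  shows "bdd_lipschitz f"
proof (rule bdd_lipschitzI[OF assms(1)])
  fix t u :: real assume "0 \<le> t" "0 \<le> u"
  then have "norm (f t - f u) \<le> C * norm (t - u)"
    using assms by (intro field_differentiable_bound[of "{0..}" f f']) auto
  then show "\<bar>f t - f u\<bar> \<le> C * \<bar>t - u\<bar>" by simp
qed

lemma bdd_lipschitz_continuous_on: "bdd_lipschitz f \<Longrightarrow> continuous_on {0..} f"
  unfolding bdd_lipschitz_def by (auto intro: lipschitz_on_continuous_on)

lemmas bdd_lipschitz_intros = bdd_lipschitz_const bdd_lipschitz_add bdd_lipschitz_diff
  bdd_lipschitz_mult bdd_lipschitz_sum bdd_lipschitz_abs

text \<open>The primitive \<open>G\<close> is increasing and bounded, so it has a limit, and
  Barbalat's lemma applies to \<open>G\<close> with derivative \<open>g\<close>.\<close>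

lemma bounded_integral_imp_tendsto_0:
  assumes g: "bdd_lipschitz g" and nonneg: "\<And>t. 0 \<le> t \<Longrightarrow> 0 \<le> g t"
    and bound: "\<And>t. 0 \<le> t \<Longrightarrow> integral {0..t} g \<le> K"
  shows "(g \<longlongrightarrow> 0) at_top"
proof -
  define G where "G t = integral {0..t} g" for t
  have cont: "continuous_on {0..t} g" for t
    using bdd_lipschitz_continuous_on[OF g] by (rule continuous_on_subset) auto
  have mono: "G t \<le> G u" if "t \<le> u" for t u
    unfolding G_def
  proof (rule integral_subset_le)
    show "g integrable_on {0..t}" "g integrable_on {0..u}"
      using cont by (auto intro: integrable_continuous_real)
  qed (use that nonneg in auto)
  have bdd: "bdd_above (range G)"
    using mono[OF max.cobounded1] bound unfolding G_def
    by (intro bdd_aboveI2[of _ _ K]) (metis max.cobounded2 order_trans)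
  have lim: "(G \<longlongrightarrow> (SUP t. G t)) at_top"
  proof (rule increasing_tendsto)
    show "eventually (\<lambda>t. G t \<le> (SUP t. G t)) at_top"
      using bdd by (intro always_eventually allI cSUP_upper) auto
    fix y assume "y < (SUP t. G t)"
    then obtain t where "y < G t" using less_cSUP_iff[OF _ bdd] by auto
    then show "eventually (\<lambda>t. y < G t) at_top"
      using mono unfolding eventually_at_top_linorder by (meson less_le_trans)
  qed
  obtain C where C: "C-lipschitz_on {0..} g" using g unfolding bdd_lipschitz_def by auto
  have "(G has_real_derivative g t) (at t within {0..})" if "0 \<le> t" for t
  proof -
    have "(G has_real_derivative g t) (at t within {0..t + 1})"
      unfolding G_def using that by (intro integral_has_real_derivative cont) auto
    \<comment> \<open>The derivative is local: near t the compact interval and the half-line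
      coincide, also at the one-sided point t = 0.\<close>
    moreover have "at t within {0..t + 1} = at t within {0..}"
      by (rule at_within_nhd[of _ "{t - 1<..<t + 1}"]) auto
    ultimately show ?thesis by simp
  qed
  then show ?thesis using C lim by (rule barbalat)
qed

section \<open>A smooth convex approximation of the absolute value\<close>

text \<open>One branch of a hyperbola, within e of the absolute value everywhere. It avoids
  differentiating the absolute value of \<open>\<delta>\<close> where \<open>\<delta>\<close>
  vanishes.\<close>

definition soft_abs :: "real \<Rightarrow> real \<Rightarrow> real" where
  "soft_abs e u = sqrt (u\<^sup>2 + e\<^sup>2)"

lemma soft_abs_pos: "0 < e \<Longrightarrow> 0 < soft_abs e u"
  unfolding soft_abs_def by (simp add: add_nonneg_pos)

lemma soft_abs_0: "0 < e \<Longrightarrow> soft_abs e 0 = e"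
  by (simp add: soft_abs_def)

lemma soft_abs_ge: "\<bar>u\<bar> \<le> soft_abs e u"
  unfolding soft_abs_def by (rule real_le_rsqrt) simp

lemma soft_abs_ge': "0 < e \<Longrightarrow> e \<le> soft_abs e u"
  unfolding soft_abs_def by (rule real_le_rsqrt) simp

lemma soft_abs_le: "0 < e \<Longrightarrow> soft_abs e u \<le> \<bar>u\<bar> + e"
  unfolding soft_abs_def by (rule real_le_lsqrt) (simp_all add: power2_sum)

lemma has_derivative_soft_abs:
  assumes "0 < e"
  shows "(soft_abs e has_real_derivative u / soft_abs e u) (at u)"
proof -
  have "0 < u\<^sup>2 + e\<^sup>2" using assms by (simp add: add_nonneg_pos)
  then show ?thesis
    unfolding soft_abs_def by (auto intro!: derivative_eq_intros simp: field_simps)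
qed

lemma soft_abs_deriv_le_1: "0 < e \<Longrightarrow> \<bar>u / soft_abs e u\<bar> \<le> 1"
  using soft_abs_pos[of e u] soft_abs_ge[of u e] by (simp add: abs_divide divide_le_eq)

text \<open>Tangent-line form of convexity: it turns each discrete drift term of the Lyapunov function
  below into a telescoping difference.\<close>

lemma soft_abs_convex:
  assumes "0 < e"
  shows "u / soft_abs e u * (v - u) \<le> soft_abs e v - soft_abs e u"
proof -
  have pos: "0 < soft_abs e u" using assms by (rule soft_abs_pos)
  have sq: "soft_abs e u * soft_abs e u = u\<^sup>2 + e\<^sup>2" 
    unfolding soft_abs_def by (simp add: power2_eq_square)
  \<comment> \<open>Lagrange's identity for the vectors (u, e) and (v, e); dropping a square gives
    Cauchy-Schwarz.\<close>
  have "(u * v + e * e)\<^sup>2 + (e * (u - v))\<^sup>2 = (u\<^sup>2 + e\<^sup>2) * (v\<^sup>2 + e\<^sup>2)"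
    by (simp add: power2_eq_square algebra_simps)
  then have "(u * v + e * e)\<^sup>2 \<le> (u\<^sup>2 + e\<^sup>2) * (v\<^sup>2 + e\<^sup>2)"
    by (smt (verit) zero_le_power2)
  then have "u * v + e * e \<le> soft_abs e u * soft_abs e v"
    unfolding soft_abs_def real_sqrt_mult[symmetric] by (rule real_le_rsqrt)
  then have "u * (v - u) \<le> (soft_abs e v - soft_abs e u) * soft_abs e u"
    using sq by (simp add: algebra_simps power2_eq_square)
  then show ?thesis using pos by (simp add: divide_le_eq)
qed

section \<open>The Lyapunov function\<close>

text \<open>\<open>pi_b\<close> in terms of the tails \<open>s c n = x c n + x c (n + 1) + \<dots>\<close>, for which
  \<open>s c 1 = 1 - x c 0\<close>.\<close>

definition service :: "('c::finite \<Rightarrow> real) \<Rightarrow> ('c \<Rightarrow> real) \<Rightarrow> 'c state \<Rightarrow> real" where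
  "service mu nu s = 1 / (1 + (\<Sum>c\<in>UNIV. nu c / mu c * s c 1))"

text \<open>The system in tail coordinates only, so that the stability argument is independent of
  \<open>E1\<close> and \<open>H\<close>. Summability at time 0 is what finite initial mass
  becomes.\<close>

locale tail_flow =
  fixes lam mu nu p :: "'c::finite \<Rightarrow> real" and s :: "real \<Rightarrow> 'c state"
  assumes lam_pos: "\<And>c. 0 < lam c" and mu_pos: "\<And>c. 0 < mu c"
    and nu_pos: "\<And>c. 0 < nu c" and p_pos: "\<And>c. 0 < p c"
    and subcritical: "\<And>c. lam c / nu c < 1 - (\<Sum>d\<in>UNIV. lam d / mu d)"
    and tail_0: "\<And>t c. 0 \<le> t \<Longrightarrow> s t c 0 = 1"
    and tail_Suc_le: "\<And>t c n. 0 \<le> t \<Longrightarrow> s t c (Suc n) \<le> s t c n"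
    and tail_tendsto: "\<And>t c. 0 \<le> t \<Longrightarrow> (\<lambda>n. s t c n) \<longlonglongrightarrow> 0"
    and tail_deriv: "\<And>t c n. 0 \<le> t \<Longrightarrow>
      ((\<lambda>t. s t c (Suc n)) has_real_derivative
        (lam c * (s t c n - s t c (Suc n))
          - service mu nu (s t) * nu c * (s t c (Suc n) - s t c (Suc (Suc n)))) / p c)
      (at t within {0..})"
    and tail_summable: "\<And>c. summable (\<lambda>n. s 0 c (Suc n))"
begin

section \<open>Equilibrium constants and a priori bounds\<close>

abbreviation "\<pi> t \<equiv> service mu nu (s t)"
definition "pi_star = 1 - (\<Sum>d\<in>UNIV. lam d / mu d)"
definition "\<xi> c = lam c / (nu c * pi_star)"
definition "\<delta> t c n = s t c n - \<xi> c ^ n"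
definition "weight_sum = (\<Sum>c\<in>UNIV. nu c / mu c)"

lemma pi_star_pos: "0 < pi_star"
  using subcritical[of undefined] lam_pos[of undefined] nu_pos[of undefined]
  unfolding pi_star_def by (meson divide_pos_pos less_trans)

lemma xi_pos: "0 < \<xi> c"
  unfolding \<xi>_def using lam_pos nu_pos pi_star_pos by simp

lemma xi_less_1: "\<xi> c < 1"
  using subcritical[of c] nu_pos[of c] pi_star_pos
  unfolding \<xi>_def pi_star_def[symmetric] by (simp add: field_simps)

lemma weight_nonneg: "0 \<le> nu c / mu c"
  using nu_pos[of c] mu_pos[of c] by simp

text \<open>Self-consistency of the equilibrium: the service rate of the state with tails
  \<open>\<xi> c ^ n\<close> is again \<open>pi_star\<close>. Each summand is
  \<open>lam c / mu c / pi_star\<close>, and the ratios \<open>lam c / mu c\<close> add up to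
  \<open>1 - pi_star\<close>.\<close>

lemma pi_star_eq: "1 / pi_star = 1 + (\<Sum>c\<in>UNIV. nu c / mu c * \<xi> c)"
proof -
  have "nu c / mu c * \<xi> c = lam c / mu c / pi_star" for c
    using nu_pos[of c] by (simp add: \<xi>_def)
  then have "(\<Sum>c\<in>UNIV. nu c / mu c * \<xi> c) = (\<Sum>c\<in>UNIV. lam c / mu c) / pi_star"
    by (simp only: sum_divide_distrib)
  also have "\<dots> = (1 - pi_star) / pi_star" by (simp add: pi_star_def)
  finally have "(\<Sum>c\<in>UNIV. nu c / mu c * \<xi> c) = (1 - pi_star) / pi_star" .
  then show ?thesis using pi_star_pos by (simp add: field_simps)
qed

lemma tail_nonneg: "0 \<le> t \<Longrightarrow> 0 \<le> s t c n"
  using decseq_ge[OF decseq_SucI[of "s t c"] tail_tendsto] tail_Suc_le by blast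

lemma tail_le_1: "0 \<le> t \<Longrightarrow> s t c n \<le> 1"
  by (induction n) (auto simp: tail_0 intro: order_trans[OF tail_Suc_le])

lemma inverse_service: "1 / \<pi> t = 1 + (\<Sum>c\<in>UNIV. nu c / mu c * s t c 1)"
  by (simp add: service_def)

lemma one_le_inverse_service: "0 \<le> t \<Longrightarrow> 1 \<le> 1 + (\<Sum>c\<in>UNIV. nu c / mu c * s t c 1)"
  by (simp add: sum_nonneg weight_nonneg tail_nonneg del: times_divide_eq_left)

lemma weight_sum_nonneg: "0 \<le> weight_sum"
  unfolding weight_sum_def by (intro sum_nonneg weight_nonneg)

lemma service_bounds:
  assumes "0 \<le> t"
  shows "0 < \<pi> t" "\<pi> t \<le> 1" "1 / (1 + weight_sum) \<le> \<pi> t"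
proof -
  have 1: "1 \<le> 1 + (\<Sum>c\<in>UNIV. nu c / mu c * s t c 1)"
    using assms by (rule one_le_inverse_service)
  have "nu c / mu c * s t c 1 \<le> nu c / mu c" for c
    using tail_le_1[OF assms] weight_nonneg by (intro mult_left_le) auto
  then have 2: "1 + (\<Sum>c\<in>UNIV. nu c / mu c * s t c 1) \<le> 1 + weight_sum"
    unfolding weight_sum_def by (intro add_left_mono sum_mono)
  show "0 < \<pi> t" "\<pi> t \<le> 1" using 1 by (auto simp: service_def divide_le_eq)
  show "1 / (1 + weight_sum) \<le> \<pi> t"
    unfolding service_def using 1 2 by (intro divide_left_mono) auto
qed

text \<open>The derivative is bounded, since \<open>\<pi> t\<close> and the differences of
  consecutive tails all lie in [0, 1].\<close>

lemma bdd_lipschitz_tail: "bdd_lipschitz (\<lambda>t. s t c n)"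
proof (cases n)
  case 0
  then show ?thesis by (intro bdd_lipschitzI[of _ 1 0]) (auto simp: tail_0)
next
  case (Suc m)
  show ?thesis
    unfolding Suc
  proof (rule bdd_lipschitz_deriv[OF _ tail_deriv])
    fix t :: real assume t: "0 \<le> t"
    have d: "0 \<le> s t c m - s t c (Suc m)" "s t c m - s t c (Suc m) \<le> 1"
      "0 \<le> s t c (Suc m) - s t c (Suc (Suc m))" "s t c (Suc m) - s t c (Suc (Suc m)) \<le> 1"
      using tail_Suc_le[OF t, of c] tail_le_1[OF t, of c] tail_nonneg[OF t, of c]
      by (auto simp: diff_le_eq add_increasing2)
    show "\<bar>s t c (Suc m)\<bar> \<le> 1" using tail_nonneg[OF t] tail_le_1[OF t] by simp
    have "0 \<le> lam c * (s t c m - s t c (Suc m))" "lam c * (s t c m - s t c (Suc m)) \<le> lam c"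
      using d lam_pos[of c] by (auto intro: mult_left_le)
    moreover have "0 \<le> \<pi> t * nu c * (s t c (Suc m) - s t c (Suc (Suc m)))"
      using d nu_pos[of c] service_bounds(1)[OF t] by simp
    moreover have "\<pi> t * nu c * (s t c (Suc m) - s t c (Suc (Suc m))) \<le> 1 * nu c * 1"
      using d nu_pos[of c] service_bounds[OF t] by (intro mult_mono) auto
    ultimately have "\<bar>lam c * (s t c m - s t c (Suc m))
        - \<pi> t * nu c * (s t c (Suc m) - s t c (Suc (Suc m)))\<bar> \<le> lam c + nu c"
      using lam_pos[of c] nu_pos[of c] by linarith
    then show "\<bar>(lam c * (s t c m - s t c (Suc m))
        - \<pi> t * nu c * (s t c (Suc m) - s t c (Suc (Suc m)))) / p c\<bar> \<le> (lam c + nu c) / p c"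
      using p_pos[of c] by (simp add: abs_divide divide_right_mono)
  qed
qed

lemma bdd_lipschitz_service: "bdd_lipschitz \<pi>"
  unfolding service_def
  by (intro bdd_lipschitz_inverse bdd_lipschitz_intros bdd_lipschitz_tail one_le_inverse_service)

lemma bdd_lipschitz_delta: "bdd_lipschitz (\<lambda>t. \<delta> t c n)"
  unfolding \<delta>_def by (intro bdd_lipschitz_intros bdd_lipschitz_tail)

lemma delta_0: "0 \<le> t \<Longrightarrow> \<delta> t c 0 = 0"
  by (simp add: \<delta>_def tail_0)

lemma abs_delta_le_1:
  assumes "0 \<le> t"
  shows "\<bar>\<delta> t c n\<bar> \<le> 1"
proof -
  have "0 \<le> \<xi> c ^ n" "\<xi> c ^ n \<le> 1"
    using xi_pos[of c] xi_less_1[of c] by (auto intro: power_le_one)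
  then show ?thesis unfolding \<delta>_def using tail_nonneg[OF assms, of c n] tail_le_1[OF assms, of c n]
    by linarith
qed

lemma delta_tendsto:
  assumes "0 \<le> t"
  shows "(\<lambda>n. \<delta> t c n) \<longlonglongrightarrow> 0"
proof -
  have "(\<lambda>n. \<xi> c ^ n) \<longlonglongrightarrow> 0"
    using xi_pos[of c] xi_less_1[of c] by (intro LIMSEQ_power_zero) auto
  then show ?thesis
    unfolding \<delta>_def using tendsto_diff[OF tail_tendsto[OF assms]] by fastforce
qed

text \<open>The tail equation minus its stationary version, with the differences of \<open>\<delta>\<close> at the constant
  rate \<open>pi_star\<close>; only the last term sees \<open>\<pi> t\<close>.\<close>

definition "drift t c n = lam c * (\<delta> t c n - \<delta> t c (Suc n))
  + nu c * pi_star * (\<delta> t c (Suc (Suc n)) - \<delta> t c (Suc n))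
  + nu c * (pi_star - \<pi> t) * (s t c (Suc n) - s t c (Suc (Suc n)))"

lemma delta_deriv:
  assumes "0 \<le> t"
  shows "((\<lambda>t. \<delta> t c (Suc n)) has_real_derivative drift t c n / p c) (at t within {0..})"
proof -
  \<comment> \<open>Balance between adjacent levels at equilibrium; it cancels all powers of
    \<open>\<xi> c\<close> in \<open>drift\<close>.\<close>
  have "lam c = nu c * pi_star * \<xi> c"
    using nu_pos[of c] pi_star_pos by (simp add: \<xi>_def)
  then have "drift t c n = lam c * (s t c n - s t c (Suc n))
      - \<pi> t * nu c * (s t c (Suc n) - s t c (Suc (Suc n)))"
    unfolding drift_def \<delta>_def by (simp add: algebra_simps)
  then show ?thesis
    unfolding \<delta>_def using DERIV_diff[OF tail_deriv[OF assms] DERIV_const] by simp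
qed

section \<open>The truncated Lyapunov function and its dissipation\<close>

definition "V e N t = (\<Sum>c\<in>UNIV. p c / mu c * (\<Sum>n<N. soft_abs e (\<delta> t c (Suc n))))"

definition "V' e N t =
  (\<Sum>c\<in>UNIV. 1 / mu c * (\<Sum>n<N. \<delta> t c (Suc n) / soft_abs e (\<delta> t c (Suc n)) * drift t c n))"

definition "gap t = (\<Sum>c\<in>UNIV. nu c / mu c * \<bar>\<delta> t c 1\<bar>)"

lemma V_deriv:
  assumes "0 < e" "0 \<le> t"
  shows "(V e N has_real_derivative V' e N t) (at t within {0..})"
proof -
  have "((\<lambda>t. soft_abs e (\<delta> t c (Suc n))) has_real_derivative
      \<delta> t c (Suc n) / soft_abs e (\<delta> t c (Suc n)) * (drift t c n / p c)) (at t within {0..})" for c n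
    using DERIV_chain2[OF has_derivative_soft_abs[OF assms(1)] delta_deriv[OF assms(2)]] .
  then have "(V e N has_real_derivative (\<Sum>c\<in>UNIV. p c / mu c * (\<Sum>n<N.
      \<delta> t c (Suc n) / soft_abs e (\<delta> t c (Suc n)) * (drift t c n / p c)))) (at t within {0..})"
    unfolding V_def by (intro DERIV_sum DERIV_cmult)
  also have "(\<Sum>c\<in>UNIV. p c / mu c * (\<Sum>n<N.
      \<delta> t c (Suc n) / soft_abs e (\<delta> t c (Suc n)) * (drift t c n / p c))) = V' e N t"
    unfolding V'_def
  proof (rule sum.cong)
    fix c
    \<comment> \<open>The weight \<open>p c\<close> in \<open>V\<close> is chosen to cancel the time
      scale \<open>1 / p c\<close> of class c.\<close>
    have "p c / mu c * (a * (b / p c)) = 1 / mu c * (a * b)" for a b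
      using p_pos[of c] by simp
    then show "p c / mu c * (\<Sum>n<N. \<delta> t c (Suc n) / soft_abs e (\<delta> t c (Suc n)) * (drift t c n / p c))
      = 1 / mu c * (\<Sum>n<N. \<delta> t c (Suc n) / soft_abs e (\<delta> t c (Suc n)) * drift t c n)"
      unfolding sum_distrib_left by (intro sum.cong refl)
  qed simp
  finally show ?thesis .
qed

text \<open>Convexity bounds the arrival and departure terms by telescoping differences of
  \<open>soft_abs\<close>. In the coupling term the slope has modulus at most 1, so the sign of
  \<open>pi_star - \<pi> t\<close> does not matter, and the tails telescope. What remains are
  boundary terms, with the loss at level 1.\<close>

lemma class_drift_le:
  assumes e: "0 < e" and t: "0 \<le> t"
  shows "(\<Sum>n<N. \<delta> t c (Suc n) / soft_abs e (\<delta> t c (Suc n)) * drift t c n)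
    \<le> nu c * pi_star * (\<bar>\<delta> t c (Suc N)\<bar> + e - \<bar>\<delta> t c 1\<bar>) + nu c * (\<bar>pi_star - \<pi> t\<bar> * s t c 1)"
proof -
  define \<phi> where "\<phi> n = soft_abs e (\<delta> t c n)" for n
  let ?q = "\<bar>pi_star - \<pi> t\<bar>"
  have "\<delta> t c (Suc n) / \<phi> (Suc n) * drift t c n \<le>
      lam c * (\<phi> n - \<phi> (Suc n)) + nu c * pi_star * (\<phi> (Suc (Suc n)) - \<phi> (Suc n))
      + nu c * (?q * (s t c (Suc n) - s t c (Suc (Suc n))))" for n
  proof -
    let ?d = "\<delta> t c (Suc n) / \<phi> (Suc n)"
    have "lam c * (?d * (\<delta> t c n - \<delta> t c (Suc n))) \<le> lam c * (\<phi> n - \<phi> (Suc n))"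
      unfolding \<phi>_def using lam_pos[of c] by (intro mult_left_mono soft_abs_convex e) auto
    moreover have "nu c * pi_star * (?d * (\<delta> t c (Suc (Suc n)) - \<delta> t c (Suc n)))
        \<le> nu c * pi_star * (\<phi> (Suc (Suc n)) - \<phi> (Suc n))"
      unfolding \<phi>_def using nu_pos[of c] pi_star_pos by (intro mult_left_mono soft_abs_convex e) auto
    moreover have "nu c * ((?d * (pi_star - \<pi> t)) * (s t c (Suc n) - s t c (Suc (Suc n))))
        \<le> nu c * (?q * (s t c (Suc n) - s t c (Suc (Suc n))))"
    proof (intro mult_left_mono mult_right_mono)
      have "?d * (pi_star - \<pi> t) \<le> \<bar>?d\<bar> * ?q" unfolding abs_mult[symmetric] by (rule abs_ge_self)
      also have "\<dots> \<le> 1 * ?q"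
        unfolding \<phi>_def by (intro mult_right_mono soft_abs_deriv_le_1 e) auto
      finally show "?d * (pi_star - \<pi> t) \<le> ?q" by simp
    qed (use nu_pos[of c] tail_Suc_le[OF t] in auto)
    \<comment> \<open>Distributes the slope over the three terms of \<open>drift\<close>, so that
      the three bounds can be added.\<close>
    moreover have "d * (l * a + m * b + v * q * z) = l * (d * a) + m * (d * b) + v * ((d * q) * z)"
      for d l a m b v q z :: real by (simp add: algebra_simps)
    ultimately show ?thesis unfolding drift_def by (simp only: add_mono)
  qed
  then have "(\<Sum>n<N. \<delta> t c (Suc n) / \<phi> (Suc n) * drift t c n) \<le>
    (\<Sum>n<N. lam c * (\<phi> n - \<phi> (Suc n)) + nu c * pi_star * (\<phi> (Suc (Suc n)) - \<phi> (Suc n))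
      + nu c * (?q * (s t c (Suc n) - s t c (Suc (Suc n)))))"
    by (rule sum_mono)
  also have "\<dots> = lam c * (\<phi> 0 - \<phi> N) + nu c * pi_star * (\<phi> (Suc N) - \<phi> 1)
      + nu c * (?q * (s t c 1 - s t c (Suc N)))"
    by (induction N) (simp_all add: algebra_simps)
  also have "\<dots> \<le> 0 + nu c * pi_star * (\<bar>\<delta> t c (Suc N)\<bar> + e - \<bar>\<delta> t c 1\<bar>) + nu c * (?q * s t c 1)"
  proof (intro add_mono)
    \<comment> \<open>\<open>soft_abs\<close> has its minimum e at 0, and \<open>\<delta>\<close> is
      pinned to 0 at level 0.\<close>
    have "\<phi> 0 \<le> \<phi> N" 
      unfolding \<phi>_def by (simp add: delta_0[OF t] soft_abs_0[OF e] soft_abs_ge'[OF e])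
    then show "lam c * (\<phi> 0 - \<phi> N) \<le> 0" using lam_pos[of c] by (simp add: mult_le_0_iff)
    show "nu c * pi_star * (\<phi> (Suc N) - \<phi> 1) \<le> nu c * pi_star * (\<bar>\<delta> t c (Suc N)\<bar> + e - \<bar>\<delta> t c 1\<bar>)"
      unfolding \<phi>_def using nu_pos[of c] pi_star_pos
      by (intro mult_left_mono diff_mono soft_abs_le soft_abs_ge e) auto
    show "nu c * (?q * (s t c 1 - s t c (Suc N))) \<le> nu c * (?q * s t c 1)"
      using nu_pos[of c] tail_nonneg[OF t] by (intro mult_left_mono) auto
  qed
  finally show ?thesis unfolding \<phi>_def by simp
qed

text \<open>The weights \<open>1 / mu c\<close> make the coupling term sum up to \<open>\<bar>pi_star - \<pi> t\<bar> * (1 / \<pi> t - 1)\<close>,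
  and \<open>pi_star - \<pi> t = pi_star * \<pi> t * D\<close> with \<open>\<bar>D\<bar> \<le> gap t\<close>: it is strictly dominated by
  the loss \<open>pi_star * gap t\<close> at the boundary \<open>n = 1\<close>.\<close>

lemma V'_le:
  assumes e: "0 < e" and t: "0 \<le> t"
  shows "V' e N t \<le> pi_star * (\<Sum>c\<in>UNIV. nu c / mu c * (\<bar>\<delta> t c (Suc N)\<bar> + e))
    - pi_star / (1 + weight_sum) * gap t"
proof -
  define D where "D = (\<Sum>c\<in>UNIV. nu c / mu c * \<delta> t c 1)"
  let ?q = "\<bar>pi_star - \<pi> t\<bar>"
  have pi: "0 < \<pi> t" "\<pi> t \<le> 1" "1 / (1 + weight_sum) \<le> \<pi> t" using service_bounds[OF t] by auto
  have "D = 1 / \<pi> t - 1 / pi_star"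
    unfolding D_def inverse_service pi_star_eq by (simp add: \<delta>_def algebra_simps sum_subtractf)
  then have "pi_star - \<pi> t = pi_star * \<pi> t * D"
    using pi pi_star_pos by (simp add: field_simps)
  then have q: "?q = pi_star * \<pi> t * \<bar>D\<bar>"
    using pi pi_star_pos by (simp add: abs_mult)
  have D_le: "\<bar>D\<bar> \<le> gap t"
    unfolding D_def gap_def
    by (rule order_trans[OF sum_abs]) (simp add: abs_mult weight_nonneg del: times_divide_eq_left abs_divide)
  have "V' e N t \<le> (\<Sum>c\<in>UNIV. 1 / mu c * (nu c * pi_star * (\<bar>\<delta> t c (Suc N)\<bar> + e - \<bar>\<delta> t c 1\<bar>)
      + nu c * (?q * s t c 1)))"
    unfolding V'_def using class_drift_le[OF e t] mu_pos
    by (intro sum_mono mult_left_mono) (auto simp: less_imp_le)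
  also have "\<dots> = (\<Sum>c\<in>UNIV. pi_star * (nu c / mu c * (\<bar>\<delta> t c (Suc N)\<bar> + e))
      - pi_star * (nu c / mu c * \<bar>\<delta> t c 1\<bar>) + ?q * (nu c / mu c * s t c 1))"
    using mu_pos by (intro sum.cong) (auto simp: field_simps less_imp_neq[symmetric])
  also have "\<dots> = pi_star * (\<Sum>c\<in>UNIV. nu c / mu c * (\<bar>\<delta> t c (Suc N)\<bar> + e))
      - pi_star * gap t + ?q * (\<Sum>c\<in>UNIV. nu c / mu c * s t c 1)"
    unfolding gap_def by (simp add: sum.distrib sum_subtractf sum_distrib_left)
  also have "?q * (\<Sum>c\<in>UNIV. nu c / mu c * s t c 1) = ?q * (1 / \<pi> t - 1)"
    unfolding inverse_service by simp
  also have "\<dots> = pi_star * (\<bar>D\<bar> * (1 - \<pi> t))"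
    unfolding q using pi by (simp add: field_simps)
  also have "\<dots> \<le> pi_star * (gap t * (1 - \<pi> t))"
    using D_le pi pi_star_pos by (intro mult_left_mono mult_right_mono) auto
  \<comment> \<open>The coupling uses up the fraction \<open>1 - \<pi> t\<close> of the loss
    \<open>pi_star * gap t\<close>; the fraction \<open>\<pi> t\<close> is left and is bounded below
    uniformly in time.\<close>
  finally have "V' e N t \<le> pi_star * (\<Sum>c\<in>UNIV. nu c / mu c * (\<bar>\<delta> t c (Suc N)\<bar> + e))
      - pi_star * \<pi> t * gap t" by (simp add: algebra_simps)
  moreover have "pi_star * (1 / (1 + weight_sum)) * gap t \<le> pi_star * \<pi> t * gap t"
    using D_le pi pi_star_pos by (intro mult_right_mono mult_left_mono) auto
  ultimately show ?thesis by simp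
qed

lemma bdd_lipschitz_gap: "bdd_lipschitz gap"
  unfolding gap_def by (intro bdd_lipschitz_intros bdd_lipschitz_delta)

section \<open>Integrability of the gap over time\<close>

definition "V_bound = (\<Sum>c\<in>UNIV. p c / mu c * ((\<Sum>n. s 0 c (Suc n)) + (\<Sum>n. \<xi> c ^ n) + 1))"

lemma V_nonneg: "0 < e \<Longrightarrow> 0 \<le> V e N t"
  unfolding V_def using p_pos mu_pos soft_abs_pos
  by (intro sum_nonneg mult_nonneg_nonneg) (auto simp: less_imp_le)

text \<open>The smoothing parameter is coupled to the truncation: N levels with error
  \<open>1 / Suc N\<close> each cost less than 1 in total, which is the \<open>+ 1\<close> in
  \<open>V_bound\<close>. The bound is thus uniform in N.\<close>

lemma V_initial_le: "V (1 / Suc N) N 0 \<le> V_bound"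
  unfolding V_def V_bound_def
proof (intro sum_mono mult_left_mono)
  fix c
  have sx: "summable (\<lambda>n. \<xi> c ^ n)" using xi_pos[of c] xi_less_1[of c] by (intro summable_geometric) auto
  have "soft_abs (1 / Suc N) (\<delta> 0 c (Suc n)) \<le> s 0 c (Suc n) + \<xi> c ^ n + 1 / Suc N" for n
  proof -
    have "soft_abs (1 / Suc N) (\<delta> 0 c (Suc n)) \<le> \<bar>\<delta> 0 c (Suc n)\<bar> + 1 / Suc N"
      by (rule soft_abs_le) simp
    moreover have "0 \<le> \<xi> c ^ Suc n" "\<xi> c ^ Suc n \<le> \<xi> c ^ n"
      using xi_pos[of c] xi_less_1[of c] by (auto intro: power_decreasing simp: mult_le_cancel_right1)
    ultimately show ?thesis using tail_nonneg[of 0 c "Suc n"] unfolding \<delta>_def by linarith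
  qed
  then have "(\<Sum>n<N. soft_abs (1 / Suc N) (\<delta> 0 c (Suc n)))
      \<le> (\<Sum>n<N. s 0 c (Suc n) + \<xi> c ^ n + 1 / Suc N)" by (intro sum_mono)
  also have "\<dots> = (\<Sum>n<N. s 0 c (Suc n)) + (\<Sum>n<N. \<xi> c ^ n) + N / Suc N"
    by (simp add: sum.distrib)
  also have "\<dots> \<le> (\<Sum>n. s 0 c (Suc n)) + (\<Sum>n. \<xi> c ^ n) + 1"
    using tail_summable sx tail_nonneg[of 0] xi_pos[of c]
    by (intro add_mono sum_le_suminf) (auto simp: less_imp_le)
  finally show "(\<Sum>n<N. soft_abs (1 / Suc N) (\<delta> 0 c (Suc n)))
      \<le> (\<Sum>n. s 0 c (Suc n)) + (\<Sum>n. \<xi> c ^ n) + 1" .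
qed (use p_pos mu_pos in \<open>simp add: less_imp_le\<close>)

text \<open>Integrate \<open>V'_le\<close> over [0, T], discard the nonnegative final value of
  \<open>V\<close>, and let N tend to infinity.\<close>

lemma integral_gap_le:
  assumes T: "0 \<le> T"
  shows "pi_star / (1 + weight_sum) * integral {0..T} gap \<le> V_bound"
proof -
  define h where "h N t = pi_star * (\<Sum>c\<in>UNIV. nu c / mu c * (\<bar>\<delta> t c (Suc N)\<bar> + 1 / Suc N))" for N t
  have cont: "continuous_on {0..T} f" if "bdd_lipschitz f" for f
    using bdd_lipschitz_continuous_on[OF that] by (rule continuous_on_subset) auto
  have h_int: "h N integrable_on {0..T}" for N
    unfolding h_def
    by (intro integrable_continuous_real cont bdd_lipschitz_intros bdd_lipschitz_delta)
  have gap_int: "gap integrable_on {0..T}"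
    by (intro integrable_continuous_real cont bdd_lipschitz_gap)
  \<comment> \<open>Truncating at level \<open>N\<close> costs only the boundary term \<open>h N\<close>, so neither finiteness of the mass
     at positive times nor differentiation of an infinite sum is needed.\<close>
  have "pi_star / (1 + weight_sum) * integral {0..T} gap \<le> V_bound + integral {0..T} (h N)" for N
  proof -
    have "(V' (1 / Suc N) N has_integral V (1 / Suc N) N T - V (1 / Suc N) N 0) {0..T}"
      using T by (intro fundamental_theorem_of_calculus)
        (auto simp: has_real_derivative_iff_has_vector_derivative[symmetric]
          intro: DERIV_subset[OF V_deriv])
    moreover have "((\<lambda>t. h N t - pi_star / (1 + weight_sum) * gap t) has_integral
        integral {0..T} (h N) - pi_star / (1 + weight_sum) * integral {0..T} gap) {0..T}"
      using h_int gap_int by (intro has_integral_diff has_integral_mult_right) auto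
    ultimately have "V (1 / Suc N) N T - V (1 / Suc N) N 0
        \<le> integral {0..T} (h N) - pi_star / (1 + weight_sum) * integral {0..T} gap"
      by (rule has_integral_le) (use V'_le[of "1 / Suc N"] in \<open>auto simp: h_def\<close>)
    then show ?thesis using V_nonneg[of "1 / Suc N" N T] V_initial_le[of N] by simp
  qed
  \<comment> \<open>At each time \<open>\<delta>\<close> vanishes as the level grows, and so does
    the smoothing parameter; as both are at most 1 in modulus, a constant dominates.\<close>
  moreover have "(\<lambda>N. integral {0..T} (h N)) \<longlonglongrightarrow> integral {0..T} (\<lambda>t. 0)"
  proof (rule dominated_convergence(2))
    show "h N integrable_on {0..T}" for N by (rule h_int)
    show "(\<lambda>t. pi_star * (\<Sum>c\<in>UNIV. nu c / mu c * (1 + 1))) integrable_on {0..T}"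
      by (rule integrable_const_ivl)
    fix t assume "t \<in> {0..T}"
    then have t: "0 \<le> t" by simp
    show "norm (h N t) \<le> pi_star * (\<Sum>c\<in>UNIV. nu c / mu c * (1 + 1))" for N
    proof -
      have "0 \<le> h N t"
        unfolding h_def using pi_star_pos weight_nonneg by (intro mult_nonneg_nonneg sum_nonneg) auto
      moreover have "h N t \<le> pi_star * (\<Sum>c\<in>UNIV. nu c / mu c * (1 + 1))"
        unfolding h_def using pi_star_pos weight_nonneg abs_delta_le_1[OF t]
        by (intro mult_left_mono sum_mono add_mono) auto
      ultimately show ?thesis by simp
    qed
    have "(\<lambda>N. \<bar>\<delta> t c (Suc N)\<bar> + 1 / Suc N) \<longlonglongrightarrow> 0" for c
      using tendsto_add[OF tendsto_rabs_zero[OF LIMSEQ_Suc[OF delta_tendsto[OF t]]]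
          LIMSEQ_Suc[OF lim_1_over_n]] by simp
    then have "h' \<longlonglongrightarrow> pi_star * (\<Sum>c\<in>UNIV. nu c / mu c * 0)"
      if "h' = (\<lambda>N. h N t)" for h'
      unfolding that h_def by (intro tendsto_intros)
    then show "(\<lambda>N. h N t) \<longlonglongrightarrow> 0" by simp
  qed
  then have "(\<lambda>N. V_bound + integral {0..T} (h N)) \<longlonglongrightarrow> V_bound + 0"
    by (intro tendsto_add tendsto_const) simp
  ultimately show ?thesis
    by (intro LIMSEQ_le_const[where x = V_bound]) auto
qed

section \<open>Convergence of the service rate and of all tails\<close>

lemma gap_tendsto: "(gap \<longlongrightarrow> 0) at_top"
proof (rule bounded_integral_imp_tendsto_0[OF bdd_lipschitz_gap])
  show "0 \<le> gap t" for t
    unfolding gap_def using weight_nonneg by (intro sum_nonneg mult_nonneg_nonneg) auto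
  fix t :: real assume "0 \<le> t"
  then show "integral {0..t} gap \<le> V_bound / (pi_star / (1 + weight_sum))"
    using integral_gap_le[of t] pi_star_pos weight_sum_nonneg
    by (subst pos_le_divide_eq) (simp_all only: mult.commute divide_pos_pos add_pos_nonneg zero_less_one)
qed

lemma tail_1_tendsto: "((\<lambda>t. s t c 1) \<longlongrightarrow> \<xi> c) at_top"
proof -
  have pos: "0 < nu c / mu c" using nu_pos mu_pos by simp
  have "nu c / mu c * \<bar>\<delta> t c 1\<bar> \<le> gap t" for t
    unfolding gap_def by (intro member_le_sum mult_nonneg_nonneg weight_nonneg abs_ge_zero) auto
  then have le: "\<bar>\<delta> t c 1\<bar> \<le> gap t / (nu c / mu c)" for t
    using pos by (simp add: pos_le_divide_eq mult.commute del: divide_divide_eq_right)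
  have "((\<lambda>t. gap t / (nu c / mu c)) \<longlongrightarrow> 0) at_top"
    using gap_tendsto by (rule tendsto_divide_zero)
  then have "((\<lambda>t. \<delta> t c 1) \<longlongrightarrow> 0) at_top"
    by (rule Lim_null_comparison[rotated]) (use le in \<open>auto intro: always_eventually\<close>)
  from tendsto_add[OF this tendsto_const[of "\<xi> c"]] show ?thesis by (simp add: \<delta>_def)
qed

text \<open>The service rate sees the state only through level 1, and \<open>pi_star_eq\<close>
  identifies the limit.\<close>

lemma service_tendsto: "(\<pi> \<longlongrightarrow> pi_star) at_top"
proof -
  have "((\<lambda>t. 1 / (1 + (\<Sum>c\<in>UNIV. nu c / mu c * s t c 1))) \<longlongrightarrow> 1 / (1 / pi_star)) at_top"
    unfolding pi_star_eq using pi_star_pos pi_star_eq 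
    by (intro tendsto_intros tail_1_tendsto) (metis divide_eq_0_iff less_irrefl zero_neq_one)
  then show ?thesis by (simp add: service_def)
qed

text \<open>The equation for level n + 1 involves levels n, n + 1 and n + 2, so the induction
  carries two consecutive levels. Barbalat's lemma makes the derivative vanish in the limit, and the
  equation can be solved for level n + 2.\<close>

lemma tail_tendsto_geometric:
  "((\<lambda>t. s t c n) \<longlongrightarrow> \<xi> c ^ n) at_top \<and> ((\<lambda>t. s t c (Suc n)) \<longlongrightarrow> \<xi> c ^ Suc n) at_top"
proof (induction n)
  case 0
  have "eventually (\<lambda>t. s t c 0 = 1) at_top"
    using eventually_ge_at_top[of 0] by eventually_elim (rule tail_0)
  then show ?case using tail_1_tendsto by (auto intro: tendsto_eventually)
next
  case (Suc n)
  define d where "d t = (lam c * (s t c n - s t c (Suc n))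
    - \<pi> t * nu c * (s t c (Suc n) - s t c (Suc (Suc n)))) / p c" for t
  \<comment> \<open>Division by \<open>p c\<close> becomes multiplication by a constant, to fit the
    closure rules.\<close>
  have "d = (\<lambda>t. (lam c * (s t c n - s t c (Suc n))
    - \<pi> t * nu c * (s t c (Suc n) - s t c (Suc (Suc n)))) * (1 / p c))"
    by (simp add: d_def fun_eq_iff)
  then have "bdd_lipschitz d"
    by (simp only:) (intro bdd_lipschitz_intros bdd_lipschitz_tail bdd_lipschitz_service)
  then obtain C where C: "C-lipschitz_on {0..} d" unfolding bdd_lipschitz_def by auto
  have d_lim: "(d \<longlongrightarrow> 0) at_top"
    using tail_deriv[of _ c n, folded d_def] C Suc.IH[THEN conjunct2] by (rule barbalat)
  have eq: "lam c = nu c * pi_star * \<xi> c"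
    using nu_pos[of c] pi_star_pos by (simp add: \<xi>_def)
  have "((\<lambda>t. s t c (Suc n) - (lam c * (s t c n - s t c (Suc n)) - p c * d t) / (\<pi> t * nu c))
      \<longlongrightarrow> \<xi> c ^ Suc n - (lam c * (\<xi> c ^ n - \<xi> c ^ Suc n) - p c * 0) / (pi_star * nu c)) at_top"
    using Suc.IH nu_pos[of c] pi_star_pos
    by (intro tendsto_intros d_lim service_tendsto) auto
  \<comment> \<open>By \<open>eq\<close> the fraction is \<open>\<xi> c\<close> times the difference
    of two consecutive powers, so the limit is the next power.\<close>
  moreover have "\<xi> c ^ Suc n - (lam c * (\<xi> c ^ n - \<xi> c ^ Suc n) - p c * 0) / (pi_star * nu c)
      = \<xi> c ^ Suc (Suc n)"
    using nu_pos[of c] pi_star_pos unfolding eq by (simp add: field_simps)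
  moreover have "eventually (\<lambda>t. s t c (Suc n) - (lam c * (s t c n - s t c (Suc n)) - p c * d t) / (\<pi> t * nu c)
      = s t c (Suc (Suc n))) at_top"
    using eventually_ge_at_top[of 0]
  proof eventually_elim
    case (elim t)
    then show ?case using service_bounds(1)[OF elim] nu_pos[of c] p_pos[of c]
      by (simp add: d_def field_simps)
  qed
  ultimately have "((\<lambda>t. s t c (Suc (Suc n))) \<longlongrightarrow> \<xi> c ^ Suc (Suc n)) at_top"
    using tendsto_cong by force
  then show ?case using Suc.IH by simp
qed

end

section \<open>Reduction to tails\<close>

text \<open>Only n = k - 1 and n = k touch coordinate k, so the series is a finite sum; the case k =
  0 guards the truncated subtraction.\<close>

lemma suminf_arrivals:
  fixes f :: "nat \<Rightarrow> real"
  shows "(\<Sum>n. f n * (unit_vec c (Suc n) d k - unit_vec c n d k))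
    = (if d = c then (if k = 0 then 0 else f (k - 1)) - f k else 0)"
proof -
  have "(\<Sum>n. f n * (unit_vec c (Suc n) d k - unit_vec c n d k))
      = (\<Sum>n\<le>k. f n * (unit_vec c (Suc n) d k - unit_vec c n d k))"
    by (rule suminf_finite) (auto simp: unit_vec_def)
  also have "\<dots> = (if d = c then (if k = 0 then 0 else f (k - 1)) - f k else 0)"
    by (cases k) (simp_all add: unit_vec_def right_diff_distrib sum_subtractf if_distrib[of "(*) _"] cong: if_cong)
  finally show ?thesis .
qed

lemma suminf_departures:
  fixes f :: "nat \<Rightarrow> real"
  shows "(\<Sum>n. f (Suc n) * (unit_vec c n d k - unit_vec c (Suc n) d k))
    = (if d = c then f (Suc k) - (if k = 0 then 0 else f k) else 0)"
proof -
  have "(\<Sum>n. f (Suc n) * (unit_vec c n d k - unit_vec c (Suc n) d k))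
      = (\<Sum>n\<le>k. f (Suc n) * (unit_vec c n d k - unit_vec c (Suc n) d k))"
    by (rule suminf_finite) (auto simp: unit_vec_def)
  also have "\<dots> = (if d = c then f (Suc k) - (if k = 0 then 0 else f k) else 0)"
    by (cases k) (simp_all add: unit_vec_def right_diff_distrib sum_subtractf if_distrib[of "(*) _"] cong: if_cong)
  finally show ?thesis .
qed

lemma H_eq:
  "H lam mu nu p x d k = (lam d * ((if k = 0 then 0 else x d (k - 1)) - x d k)
    + pi_b mu nu x * nu d * (x d (Suc k) - (if k = 0 then 0 else x d k))) / p d"
proof -
  have "H lam mu nu p x d k = (\<Sum>c\<in>UNIV. if d = c then
      (lam d * ((if k = 0 then 0 else x d (k - 1)) - x d k)
        + pi_b mu nu x * nu d * (x d (Suc k) - (if k = 0 then 0 else x d k))) / p d else 0)"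
    unfolding H_def suminf_arrivals suminf_departures by (rule sum.cong) auto
  then show ?thesis by simp
qed

text \<open>Flows between levels up to n cancel in pairs; only the net flow across the edge between
  n and n + 1 is left.\<close>

lemma sum_H_eq:
  "(\<Sum>k\<le>n. H lam mu nu p x c k) = (pi_b mu nu x * nu c * x c (Suc n) - lam c * x c n) / p c"
  by (induction n) (simp_all add: H_eq add_divide_distrib diff_divide_distrib algebra_simps)

text \<open>The complement of a finite sum, so that it can be differentiated term by term; on
  \<open>E1\<close> it is the infinite sum from n on.\<close>

definition tail :: "'c state \<Rightarrow> 'c state" where
  "tail x c n = 1 - (\<Sum>k<n. x c k)"

lemma tail_0_eq: "tail x c 0 = 1"
  by (simp add: tail_def)

lemma tail_diff: "tail x c n - tail x c (Suc n) = x c n"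
  by (simp add: tail_def)

lemma service_tail: "service mu nu (tail x) = pi_b mu nu x"
  by (simp add: service_def pi_b_def tail_def)

lemma tail_LIMSEQ:
  assumes "x \<in> E1"
  shows "(\<lambda>n. tail x c n) \<longlonglongrightarrow> 0"
proof -
  have "(\<lambda>n. \<Sum>k<n. x c k) \<longlonglongrightarrow> 1"
    using assms by (auto simp: E1_def sums_def)
  from tendsto_diff[OF tendsto_const[of 1] this] show ?thesis by (simp add: tail_def)
qed

lemma solves_ivp_tail_deriv:
  assumes "solves_ivp lam mu nu p x_init x" "0 \<le> t"
  shows "((\<lambda>t. tail (x t) c (Suc n)) has_real_derivative
    (lam c * (tail (x t) c n - tail (x t) c (Suc n)) - service mu nu (tail (x t)) * nu c *
      (tail (x t) c (Suc n) - tail (x t) c (Suc (Suc n)))) / p c) (at t within {0..})"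
proof -
  have "((\<lambda>t. \<Sum>k\<le>n. x t c k) has_real_derivative (\<Sum>k\<le>n. H lam mu nu p (x t) c k)) (at t within {0..})"
    using assms by (intro DERIV_sum) (auto simp: solves_ivp_def)
  from DERIV_diff[OF DERIV_const[of 1] this]
  have "((\<lambda>t. tail (x t) c (Suc n)) has_real_derivative 0 - (\<Sum>k\<le>n. H lam mu nu p (x t) c k))
      (at t within {0..})"
    by (simp add: tail_def lessThan_Suc_atMost)
  also have "0 - (\<Sum>k\<le>n. H lam mu nu p (x t) c k) =
      (lam c * (tail (x t) c n - tail (x t) c (Suc n)) - service mu nu (tail (x t)) * nu c *
      (tail (x t) c (Suc n) - tail (x t) c (Suc (Suc n)))) / p c"
    unfolding sum_H_eq tail_diff service_tail by (simp add: diff_divide_distrib)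
  finally show ?thesis .
qed

lemma finite_mass_summable:
  assumes "x \<in> E1" "finite_mass x"
  shows "summable (\<lambda>n. real n * x c n)"
proof -
  have "mass c x \<le> (\<Sum>c\<in>UNIV. mass c x)" by (rule member_le_sum) auto
  then have "mass c x < \<infinity>" using assms(2) unfolding finite_mass_def by (rule le_less_trans)
  then have "summable (\<lambda>n. real (Suc n) * x c (Suc n))"
    using assms(1) unfolding mass_def E1_def
    by (intro summable_suminf_not_top) (auto simp: less_top)
  then show ?thesis by (subst (asm) summable_Suc_iff)
qed

text \<open>Abel summation turns the partial sums of tails into partial sums of the mass plus a
  boundary term, and that term is at most the remaining mass.\<close>

lemma summable_tail:
  assumes "x \<in> E1" "finite_mass x"
  shows "summable (\<lambda>n. tail x c (Suc n))"
proof (rule bounded_imp_summable)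
  have nonneg: "0 \<le> x c n" for n using assms by (simp add: E1_def)
  have x_sums: "(\<lambda>n. x c n) sums 1" using assms by (simp add: E1_def)
  have mass: "summable (\<lambda>n. real n * x c n)" using assms by (rule finite_mass_summable)
  have tail_eq: "tail x c n = (\<Sum>k. x c (k + n))" for n
    using suminf_minus_initial_segment[OF sums_summable[OF x_sums], of n] sums_unique[OF x_sums]
    by (simp add: tail_def)
  show "0 \<le> tail x c (Suc n)" for n
    unfolding tail_eq
    using nonneg summable_ignore_initial_segment[OF sums_summable[OF x_sums]]
    by (intro suminf_nonneg)
  have abel: "(\<Sum>k<n. tail x c (Suc k)) = (\<Sum>k<n. real k * x c k) + real n * tail x c n" for n
    by (induction n) (simp_all add: tail_def algebra_simps)
  show "(\<Sum>k\<le>n. tail x c (Suc k)) \<le> (\<Sum>k. real k * x c k)" for n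
  proof -
    \<comment> \<open>Markov-type estimate of the boundary term: the index is at least n + 1
      throughout the tail.\<close>
    have "real (Suc n) * tail x c (Suc n) = (\<Sum>k. real (Suc n) * x c (k + Suc n))"
      unfolding tail_eq using sums_summable[OF x_sums]
      by (intro suminf_mult[symmetric]) (simp only: summable_iff_shift)
    also have "\<dots> \<le> (\<Sum>k. real (k + Suc n) * x c (k + Suc n))"
    proof (rule suminf_le)
      show "summable (\<lambda>k. real (Suc n) * x c (k + Suc n))"
        using sums_summable[OF x_sums] by (intro summable_mult) (simp only: summable_iff_shift)
      show "summable (\<lambda>k. real (k + Suc n) * x c (k + Suc n))"
        using mass by (subst summable_iff_shift[where f = "\<lambda>k. real k * x c k"])
    qed (use nonneg in \<open>auto intro: mult_right_mono\<close>)
    finally show ?thesis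
      using abel[of "Suc n"] suminf_split_initial_segment[OF mass, of "Suc n"]
      by (simp add: lessThan_Suc_atMost)
  qed
qed

lemma tail_flow_solution:
  fixes lam mu nu p :: "'c::finite \<Rightarrow> real"
  assumes "\<And>c. 0 < lam c" "\<And>c. 0 < mu c" "\<And>c. 0 < nu c" "\<And>c. 0 < p c"
    and "(MAX c\<in>UNIV. lam c / nu c) < 1 - (\<Sum>d\<in>UNIV. lam d / mu d)"
    and x_init: "x_init \<in> E1" "finite_mass x_init"
    and sol: "solves_ivp lam mu nu p x_init x"
  shows "tail_flow lam mu nu p (\<lambda>t. tail (x t))"
proof
  show "lam c / nu c < 1 - (\<Sum>d\<in>UNIV. lam d / mu d)" for c
    using assms(5) by (simp add: Max_less_iff)
  have E1: "x t \<in> E1" if "0 \<le> t" for t using sol that by (simp add: solves_ivp_def)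
  show "tail (x t) c (Suc n) \<le> tail (x t) c n" if "0 \<le> t" for t c n
  proof -
    have "0 \<le> x t c n" using E1[OF that] by (simp add: E1_def)
    then show ?thesis using tail_diff[of "x t" c n] by linarith
  qed
  show "(\<lambda>n. tail (x t) c n) \<longlonglongrightarrow> 0" if "0 \<le> t" for t c
    using E1[OF that] by (rule tail_LIMSEQ)
  show "summable (\<lambda>n. tail (x 0) c (Suc n))" for c
    using sol x_init by (intro summable_tail) (auto simp: solves_ivp_def)
qed (use assms in \<open>auto intro: solves_ivp_tail_deriv simp: tail_0_eq\<close>)

section \<open>From coordinatewise convergence to convergence in the metric\<close>

lemma rho_tendsto_0:
  assumes "\<And>c n. ((\<lambda>t. x t c n) \<longlongrightarrow> y c n) F" and "F \<noteq> bot"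
  shows "((\<lambda>t. rho (x t) y) \<longlongrightarrow> 0) F"
proof -
  define a where "a c n t = 1 / 2 ^ n * (\<bar>x t c n - y c n\<bar> / (1 + \<bar>x t c n - y c n\<bar>))" for c n t
  \<comment> \<open>Tannery's theorem: the fraction in \<open>a\<close> is at most 1, so a geometric
    series dominates uniformly in t.\<close>
  have "((\<lambda>t. \<Sum>n. a c n t) \<longlongrightarrow> (\<Sum>n. 0)) F" for c
  proof (intro tannerys_theorem[THEN conjunct2, THEN conjunct2])
    fix n
    have "((\<lambda>t. a c n t) \<longlongrightarrow> 1 / 2 ^ n * (\<bar>y c n - y c n\<bar> / (1 + \<bar>y c n - y c n\<bar>))) F"
      unfolding a_def by (intro tendsto_intros assms) auto
    then show "((\<lambda>t. a c n t) \<longlongrightarrow> 0) F" by simp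
  next
    have "norm (a c n t) \<le> (1 / 2) ^ n" for n t
    proof -
      have "\<bar>x t c n - y c n\<bar> / (1 + \<bar>x t c n - y c n\<bar>) \<le> 1" by (simp add: divide_le_eq)
      then have "a c n t \<le> 1 / 2 ^ n * 1" unfolding a_def by (intro mult_left_mono) auto
      moreover have "0 \<le> a c n t" unfolding a_def by simp
      ultimately show ?thesis by (simp add: power_one_over)
    qed
    then show "\<forall>\<^sub>F (n, t) in at_top \<times>\<^sub>F F. norm (a c n t) \<le> (1 / 2) ^ n"
      by (intro always_eventually) auto
  qed (use assms in \<open>auto intro: summable_geometric\<close>)
  then have "((\<lambda>t. \<Sum>c\<in>UNIV. \<Sum>n. a c n t) \<longlongrightarrow> (\<Sum>c\<in>(UNIV :: 'a set). \<Sum>n. 0)) F"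
    by (intro tendsto_sum)
  then show ?thesis by (simp add: rho_def a_def)
qed

theorem mainTheorem6:
  fixes lam mu nu p :: "'c::finite \<Rightarrow> real"
    and x_init :: "'c state"
    and x :: "real \<Rightarrow> 'c state"
  assumes "\<And>c. lam c > 0" and "\<And>c. mu c > 0" and "\<And>c. nu c > 0" and "\<And>c. p c > 0"
    and "(\<Sum>c\<in>UNIV. p c) = 1"
    and "(MAX c\<in>UNIV. lam c / nu c) < 1 - (\<Sum>d\<in>UNIV. lam d / mu d)"
    and "x_init \<in> E1" and "finite_mass x_init"
    and "solves_ivp lam mu nu p x_init x"
  shows "x_star lam mu nu \<in> E1 \<and>
    ((\<lambda>t. rho (x t) (x_star lam mu nu)) \<longlongrightarrow> 0) at_top"
proof -
  interpret tail_flow lam mu nu p "\<lambda>t. tail (x t)"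
    using assms(1-4,6-9) by (rule tail_flow_solution)
  \<comment> \<open>The geometric distribution as differences of its tails; this gives both the
    telescoping sum 1 and the limits of the coordinates.\<close>
  have x_star: "x_star lam mu nu c n = \<xi> c ^ n - \<xi> c ^ Suc n" for c n
    by (simp add: x_star_def xi_def \<xi>_def pi_star_def algebra_simps)
  have "(\<lambda>n. \<xi> c ^ n - \<xi> c ^ Suc n) sums 1" for c
    using telescope_sums'[OF LIMSEQ_power_zero[of "\<xi> c"]] xi_pos[of c] xi_less_1[of c] by simp
  moreover have "0 \<le> \<xi> c ^ n - \<xi> c ^ Suc n" for c n
    using xi_pos[of c] xi_less_1[of c] by (simp add: mult_le_cancel_right1)
  ultimately have "x_star lam mu nu \<in> E1" unfolding E1_def x_star by simp
  moreover have "((\<lambda>t. rho (x t) (x_star lam mu nu)) \<longlongrightarrow> 0) at_top"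
  proof (rule rho_tendsto_0)
    fix c n
    have "((\<lambda>t. tail (x t) c n - tail (x t) c (Suc n)) \<longlongrightarrow> \<xi> c ^ n - \<xi> c ^ Suc n) at_top"
      using tail_tendsto_geometric[of c n] by (intro tendsto_diff) auto
    then show "((\<lambda>t. x t c n) \<longlongrightarrow> x_star lam mu nu c n) at_top"
      unfolding tail_diff x_star .
  qed simp
  ultimately show ?thesis ..
qed

end
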